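(* Let $\mathcal{E}$ be a finite-dimensional real inner product space, $K\subseteq\mathcal{E}$ a closed convex cone with dual cone $K^*$, let $a_1,\dots,a_k\in K$, and let $0<\epsilon<1$. Suppose that $c\in\mathrm{relint}(K)$ and $c=\sum_{i=1}^m c_i$ where $c_1,\dots,c_m\in K$. Let $c'$ be such that $(1-\epsilon)c\preceq_K c'\preceq_K(1+\epsilon)c$. If $b\in\mathbb{R}^k$ has all entries strictly positive, then $$(1-\epsilon)\,\mathrm{pack}(b,c)\le\mathrm{pack}(b,c')\le(1+\epsilon)\,\mathrm{pack}(b,c).$$
   Context: $x\preceq_K y$ means $y-x\in K$. The dual cone is $K^*=\{y:\langle y,x\rangle\ge0\text{ for all }x\in K\}$. For $c\in K$ and $b\in\mathbb{R}^k_+$, the packing conic program associated with $a_1,\dots,a_k$ has optimal value $$\mathrm{pack}(b,c)=\sup\{\langle c,x\rangle: x\in K^*,\ \langle a_i,x\rangle\le b_i\text{ for }i=1,\dots,k\}.$$ *)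

theory Defs
  imports "HOL-Analysis.Analysis"
begin

definition cone_le :: "'a::real_vector set \<Rightarrow> 'a \<Rightarrow> 'a \<Rightarrow> bool" where
  "cone_le K x y \<longleftrightarrow> y - x \<in> K"

definition dual_cone :: "'a::real_inner set \<Rightarrow> 'a set" where
  "dual_cone K = {y. \<forall>x\<in>K. y \<bullet> x \<ge> 0}"

(* A vector b in R^k and a family a_1, ..., a_k are functions on nat of which only the
   values at 1, ..., k matter. The program may be unbounded (for instance when k = 0),
   so its value is taken in the extended reals. *)
definition pack :: "'a::real_inner set \<Rightarrow> nat \<Rightarrow> (nat \<Rightarrow> 'a) \<Rightarrow> (nat \<Rightarrow> real) \<Rightarrow> 'a \<Rightarrow> ereal" where
  "pack K k a b c =
    (SUP x \<in> {x \<in> dual_cone K. \<forall>i\<in>{1..k}. a i \<bullet> x \<le> b i}. ereal (c \<bullet> x))"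

end

theory Submission
  imports Defs
begin

text \<open>The feasible region does not depend on the objective, so \<open>pack\<close> is, as a
  function of \<open>c\<close>, a supremum of linear functionals over a fixed subset of the dual
  cone. Hence it is monotone for the cone order (\<open>pack_mono\<close>) and positively
  homogeneous (\<open>pack_scaleR\<close>); both are applied to the two cone inequalities that
  enclose \<open>c'\<close>.\<close>

lemma pack_mono:
  assumes "cone_le K c d"
  shows "pack K k a b c \<le> pack K k a b d"
  unfolding pack_def
proof (rule SUP_mono)
  fix x assume x: "x \<in> {x \<in> dual_cone K. \<forall>i\<in>{1..k}. a i \<bullet> x \<le> b i}"
  then have "x \<bullet> (d - c) \<ge> 0"
    using assms by (auto simp: dual_cone_def cone_le_def)
  then have "ereal (c \<bullet> x) \<le> ereal (d \<bullet> x)"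
    by (simp add: inner_diff_right inner_commute)
  with x show "\<exists>y\<in>{x \<in> dual_cone K. \<forall>i\<in>{1..k}. a i \<bullet> x \<le> b i}. ereal (c \<bullet> x) \<le> ereal (d \<bullet> y)"
    by blast
qed

text \<open>Since \<open>b\<close> is nonnegative, 0 is feasible, so the supremum is over a nonempty
  set and a finite factor \<open>r \<ge> 0\<close> can be pulled out even if the value is infinite.
  Over an empty set the case \<open>r = 0\<close> would fail: the left side would be minus infinity,
  the right side 0.\<close>

lemma pack_scaleR:
  assumes "r \<ge> 0" and "\<And>i. i \<in> {1..k} \<Longrightarrow> b i \<ge> 0"
  shows "pack K k a b (r *\<^sub>R c) = ereal r * pack K k a b c"
proof -
  have "0 \<in> {x \<in> dual_cone K. \<forall>i\<in>{1..k}. a i \<bullet> x \<le> b i}"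
    using assms(2) by (simp add: dual_cone_def)
  then have "{x \<in> dual_cone K. \<forall>i\<in>{1..k}. a i \<bullet> x \<le> b i} \<noteq> {}"
    by blast
  from Sup_ereal_mult_left'[OF this, of r "\<lambda>x. ereal (c \<bullet> x)"] assms(1)
  show ?thesis
    by (simp add: pack_def)
qed

theorem proposition8p1:
  fixes K :: "'a::real_inner set"
    and k m :: nat
    and a cs :: "nat \<Rightarrow> 'a"
    and b :: "nat \<Rightarrow> real"
    and c c' :: 'a
    and \<epsilon> :: real
  assumes "\<exists>B::'a set. finite B \<and> span B = UNIV"
    and "closed K" and "convex_cone K"
    and "\<And>i. i \<in> {1..k} \<Longrightarrow> a i \<in> K"
    and "0 < \<epsilon>" and "\<epsilon> < 1"
    and "c \<in> rel_interior K"
    and "c = (\<Sum>i=1..m. cs i)"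
    and "\<And>i. i \<in> {1..m} \<Longrightarrow> cs i \<in> K"
    and "cone_le K ((1 - \<epsilon>) *\<^sub>R c) c'"
    and "cone_le K c' ((1 + \<epsilon>) *\<^sub>R c)"
    and "\<And>i. i \<in> {1..k} \<Longrightarrow> b i > 0"
  shows "ereal (1 - \<epsilon>) * pack K k a b c \<le> pack K k a b c' \<and>
         pack K k a b c' \<le> ereal (1 + \<epsilon>) * pack K k a b c"
proof -
  have scale: "pack K k a b (r *\<^sub>R c) = ereal r * pack K k a b c" if "r \<ge> 0" for r
    using that assms(12) by (intro pack_scaleR) (auto intro: less_imp_le)
  \<comment> \<open>The bounds \<open>0 < \<epsilon> < 1\<close> make both factors
    \<open>1 - \<epsilon>\<close> and \<open>1 + \<epsilon>\<close> nonnegative, as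
    \<open>scale\<close> requires.\<close>
  show ?thesis
    using pack_mono[OF assms(10), of k a b] pack_mono[OF assms(11), of k a b]
      scale[of "1 - \<epsilon>"] scale[of "1 + \<epsilon>"] assms(5,6)
    by simp
qed

end
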